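(* Let $(T,+,\Gamma)$ be a commutative ternary $\Gamma$-semiring and let $\{Q_i\}_{i\in I}$ be any family of semiprime ideals of $T$. Then the intersection $\bigcap_{i\in I}Q_i$ is also a semiprime ideal of $T$.
   Context: A ternary $\Gamma$-semiring $(T,+,\Gamma)$ consists of a set $T$, an addition $+$, a set $\Gamma$ of parameters, and a map $T\times\Gamma\times T\times\Gamma\times T\to T$, $(a,\alpha,b,\beta,c)\mapsto a_{\alpha}b_{\beta}c$, such that: $(T,+)$ is a commutative semigroup with identity element $0$; $(a_{\alpha}b_{\beta}c)_{\gamma}d_{\delta}e=a_{\alpha}b_{\beta}(c_{\gamma}d_{\delta}e)$; the product is additive in each of its three $T$-variables; and $0_{\alpha}b_{\beta}c=a_{\alpha}0_{\beta}c=a_{\alpha}b_{\beta}0=0$. It is commutative if $a_{\alpha}b_{\beta}c=b_{\beta}a_{\alpha}c=c_{\alpha}b_{\beta}a$ for all $a,b,c\in T$, $\alpha,\beta\in\Gamma$. An ideal is a nonempty $I\subseteq T$ closed under $+$ such that $a_{\alpha}b_{\beta}c\in I$ whenever at least one of $a,b,c\in T$ lies in $I$ (all $\alpha,\beta\in\Gamma$). An ideal $Q$ is semiprime if $Q\neq T$ and, for all $a\in T$ and $\alpha,\beta\in\Gamma$, $a_{\alpha}a_{\beta}a\in Q$ implies $a\in Q$.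
   Formalization: The family of semiprime ideals and the parameter set Γ are both assumed nonempty: the empty intersection is T, which is not proper, and with Γ empty the positive and the negative integers in T = ℤ are semiprime ideals with empty intersection. *)

theory Defs
  imports "HOL-Algebra.Group"
begin

(* tp a \<alpha> b \<beta> c stands for a_\<alpha> b_\<beta> c.  The additive monoid (T, +, 0) is packaged as a
   HOL-Algebra monoid record, whose operation is called mult and whose identity is called one. *)
locale ternary_gamma_semiring =
  fixes T :: "'a set"
    and add :: "'a \<Rightarrow> 'a \<Rightarrow> 'a" (infixl "\<oplus>" 65)
    and zero :: 'a ("\<zero>")
    and \<Gamma> :: "'g set"
    and tp :: "'a \<Rightarrow> 'g \<Rightarrow> 'a \<Rightarrow> 'g \<Rightarrow> 'a \<Rightarrow> 'a"
  assumes add_comm_monoid: "comm_monoid \<lparr>carrier = T, mult = (\<oplus>), one = \<zero>\<rparr>"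
    and tp_closed:
      "\<lbrakk>a \<in> T; b \<in> T; c \<in> T; \<alpha> \<in> \<Gamma>; \<beta> \<in> \<Gamma>\<rbrakk> \<Longrightarrow> tp a \<alpha> b \<beta> c \<in> T"
    and tp_assoc:
      "\<lbrakk>a \<in> T; b \<in> T; c \<in> T; d \<in> T; e \<in> T; \<alpha> \<in> \<Gamma>; \<beta> \<in> \<Gamma>; \<gamma> \<in> \<Gamma>; \<delta> \<in> \<Gamma>\<rbrakk>
        \<Longrightarrow> tp (tp a \<alpha> b \<beta> c) \<gamma> d \<delta> e = tp a \<alpha> b \<beta> (tp c \<gamma> d \<delta> e)"
    and tp_add_left:
      "\<lbrakk>a \<in> T; a' \<in> T; b \<in> T; c \<in> T; \<alpha> \<in> \<Gamma>; \<beta> \<in> \<Gamma>\<rbrakk>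
        \<Longrightarrow> tp (a \<oplus> a') \<alpha> b \<beta> c = tp a \<alpha> b \<beta> c \<oplus> tp a' \<alpha> b \<beta> c"
    and tp_add_middle:
      "\<lbrakk>a \<in> T; b \<in> T; b' \<in> T; c \<in> T; \<alpha> \<in> \<Gamma>; \<beta> \<in> \<Gamma>\<rbrakk>
        \<Longrightarrow> tp a \<alpha> (b \<oplus> b') \<beta> c = tp a \<alpha> b \<beta> c \<oplus> tp a \<alpha> b' \<beta> c"
    and tp_add_right:
      "\<lbrakk>a \<in> T; b \<in> T; c \<in> T; c' \<in> T; \<alpha> \<in> \<Gamma>; \<beta> \<in> \<Gamma>\<rbrakk>
        \<Longrightarrow> tp a \<alpha> b \<beta> (c \<oplus> c') = tp a \<alpha> b \<beta> c \<oplus> tp a \<alpha> b \<beta> c'"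
    and tp_zero_left: "\<lbrakk>b \<in> T; c \<in> T; \<alpha> \<in> \<Gamma>; \<beta> \<in> \<Gamma>\<rbrakk> \<Longrightarrow> tp \<zero> \<alpha> b \<beta> c = \<zero>"
    and tp_zero_middle: "\<lbrakk>a \<in> T; c \<in> T; \<alpha> \<in> \<Gamma>; \<beta> \<in> \<Gamma>\<rbrakk> \<Longrightarrow> tp a \<alpha> \<zero> \<beta> c = \<zero>"
    and tp_zero_right: "\<lbrakk>a \<in> T; b \<in> T; \<alpha> \<in> \<Gamma>; \<beta> \<in> \<Gamma>\<rbrakk> \<Longrightarrow> tp a \<alpha> b \<beta> \<zero> = \<zero>"

(* The parameters travel with their positions exactly as in
   a_\<alpha> b_\<beta> c = b_\<beta> a_\<alpha> c = c_\<alpha> b_\<beta> a: the first exchange swaps them, the second does not. *)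
locale comm_ternary_gamma_semiring = ternary_gamma_semiring +
  assumes tp_comm_left:
      "\<lbrakk>a \<in> T; b \<in> T; c \<in> T; \<alpha> \<in> \<Gamma>; \<beta> \<in> \<Gamma>\<rbrakk> \<Longrightarrow> tp a \<alpha> b \<beta> c = tp b \<beta> a \<alpha> c"
    and tp_comm_outer:
      "\<lbrakk>a \<in> T; b \<in> T; c \<in> T; \<alpha> \<in> \<Gamma>; \<beta> \<in> \<Gamma>\<rbrakk> \<Longrightarrow> tp a \<alpha> b \<beta> c = tp c \<alpha> b \<beta> a"

definition tgs_ideal ::
    "'a set \<Rightarrow> ('a \<Rightarrow> 'a \<Rightarrow> 'a) \<Rightarrow> 'g set \<Rightarrow> ('a \<Rightarrow> 'g \<Rightarrow> 'a \<Rightarrow> 'g \<Rightarrow> 'a \<Rightarrow> 'a) \<Rightarrow> 'a set \<Rightarrow> bool" where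
  "tgs_ideal T add \<Gamma> tp J \<longleftrightarrow>
     J \<noteq> {} \<and> J \<subseteq> T \<and> (\<forall>x\<in>J. \<forall>y\<in>J. add x y \<in> J) \<and>
     (\<forall>a\<in>T. \<forall>b\<in>T. \<forall>c\<in>T. \<forall>\<alpha>\<in>\<Gamma>. \<forall>\<beta>\<in>\<Gamma>.
        a \<in> J \<or> b \<in> J \<or> c \<in> J \<longrightarrow> tp a \<alpha> b \<beta> c \<in> J)"

definition tgs_semiprime_ideal ::
    "'a set \<Rightarrow> ('a \<Rightarrow> 'a \<Rightarrow> 'a) \<Rightarrow> 'g set \<Rightarrow> ('a \<Rightarrow> 'g \<Rightarrow> 'a \<Rightarrow> 'g \<Rightarrow> 'a \<Rightarrow> 'a) \<Rightarrow> 'a set \<Rightarrow> bool" where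
  "tgs_semiprime_ideal T add \<Gamma> tp Q \<longleftrightarrow>
     tgs_ideal T add \<Gamma> tp Q \<and> Q \<noteq> T \<and>
     (\<forall>a\<in>T. \<forall>\<alpha>\<in>\<Gamma>. \<forall>\<beta>\<in>\<Gamma>. tp a \<alpha> a \<beta> a \<in> Q \<longrightarrow> a \<in> Q)"

end

theory Submission
  imports Defs
begin

text \<open>Each closure condition on a semiprime ideal turns memberships in the set into a single
  membership in the same set, so it can be checked index by index in an intersection. Only two
  conditions are not of this kind. Nonemptiness needs an element common to all members:
  \<open>zero_in_ideal\<close> supplies \<open>\<zero>\<close>, and \<open>ideal_INT\<close> builds
  on it. Properness is inherited from any one member.\<close>

context ternary_gamma_semiring
begin

lemma zero_closed: "\<zero> \<in> T"
  using monoid.one_closed[OF comm_monoid.axioms(1)[OF add_comm_monoid]] by simp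

text \<open>A product with factor \<open>\<zero>\<close> and another factor in \<open>J\<close> is
  \<open>\<zero>\<close>, and by absorption it lies in \<open>J\<close>. Forming it takes a
  parameter: with \<open>\<Gamma>\<close> empty, the positive integers would be an ideal of the
  naturals.\<close>

lemma zero_in_ideal:
  assumes "\<Gamma> \<noteq> {}" and J: "tgs_ideal T (\<oplus>) \<Gamma> tp J"
  shows "\<zero> \<in> J"
proof -
  obtain \<gamma> where \<gamma>: "\<gamma> \<in> \<Gamma>" using assms(1) by blast
  obtain x where x: "x \<in> J" "x \<in> T" using J by (auto simp: tgs_ideal_def)
  have "tp \<zero> \<gamma> x \<gamma> x \<in> J"
    using J x \<gamma> zero_closed unfolding tgs_ideal_def by blast
  then show ?thesis using x \<gamma> by (simp add: tp_zero_left)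
qed

lemma ideal_INT:
  assumes "\<Gamma> \<noteq> {}" and "I \<noteq> {}" and J: "\<And>i. i \<in> I \<Longrightarrow> tgs_ideal T (\<oplus>) \<Gamma> tp (J i)"
  shows "tgs_ideal T (\<oplus>) \<Gamma> tp (\<Inter>i\<in>I. J i)"
proof -
  have "\<zero> \<in> (\<Inter>i\<in>I. J i)"
    by (simp add: zero_in_ideal[OF assms(1) J])
  \<comment> \<open>An index is needed here, since in HOL the intersection of an empty family is
    \<open>UNIV\<close>.\<close>
  moreover have "(\<Inter>i\<in>I. J i) \<subseteq> T"
  proof -
    obtain i where "i \<in> I" using \<open>I \<noteq> {}\<close> by blast
    then have "J i \<subseteq> T" using J[of i] by (simp add: tgs_ideal_def)
    with \<open>i \<in> I\<close> show ?thesis by blast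
  qed
  moreover have "x \<oplus> y \<in> (\<Inter>i\<in>I. J i)"
    if "x \<in> (\<Inter>i\<in>I. J i)" "y \<in> (\<Inter>i\<in>I. J i)" for x y
    using that J by (simp add: tgs_ideal_def)
  moreover have "tp a \<alpha> b \<beta> c \<in> (\<Inter>i\<in>I. J i)"
    if "a \<in> T" "b \<in> T" "c \<in> T" "\<alpha> \<in> \<Gamma>" "\<beta> \<in> \<Gamma>"
      and "a \<in> (\<Inter>i\<in>I. J i) \<or> b \<in> (\<Inter>i\<in>I. J i) \<or> c \<in> (\<Inter>i\<in>I. J i)" for a b c \<alpha> \<beta>
  proof
    fix i assume "i \<in> I"
    then have "a \<in> J i \<or> b \<in> J i \<or> c \<in> J i" using that(6) by blast
    with J[OF \<open>i \<in> I\<close>] that(1-5) show "tp a \<alpha> b \<beta> c \<in> J i"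
      unfolding tgs_ideal_def by blast
  qed
  ultimately show ?thesis
    \<comment> \<open>The \<open>ex_in_conv\<close> rule turns nonemptiness into membership of a
      schematic witness, which becomes \<open>\<zero>\<close>.\<close>
    unfolding tgs_ideal_def by (intro conjI ballI impI) (rule ex_in_conv[THEN iffD1, OF exI] | assumption)+
qed

end

theorem proposition5p2:
  fixes T :: "'a set" and add :: "'a \<Rightarrow> 'a \<Rightarrow> 'a" and zero :: 'a
    and \<Gamma> :: "'g set" and tp :: "'a \<Rightarrow> 'g \<Rightarrow> 'a \<Rightarrow> 'g \<Rightarrow> 'a \<Rightarrow> 'a"
    and I :: "'i set" and Q :: "'i \<Rightarrow> 'a set"
  assumes "comm_ternary_gamma_semiring T add zero \<Gamma> tp"
    and "\<Gamma> \<noteq> {}"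
    and "I \<noteq> {}"
    and "\<And>i. i \<in> I \<Longrightarrow> tgs_semiprime_ideal T add \<Gamma> tp (Q i)"
  shows "tgs_semiprime_ideal T add \<Gamma> tp (\<Inter>i\<in>I. Q i)"
proof -
  interpret comm_ternary_gamma_semiring T add zero \<Gamma> tp by fact
  have "tgs_ideal T add \<Gamma> tp (\<Inter>i\<in>I. Q i)"
    using assms(4) by (intro ideal_INT[OF assms(2,3)]) (simp add: tgs_semiprime_ideal_def)
  moreover have "(\<Inter>i\<in>I. Q i) \<noteq> T"
  proof -
    obtain i where "i \<in> I" using \<open>I \<noteq> {}\<close> by blast
    then have "Q i \<subset> T"
      using assms(4)[of i] by (simp add: tgs_semiprime_ideal_def tgs_ideal_def psubset_eq)
    with \<open>i \<in> I\<close> show ?thesis by blast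
  qed
  \<comment> \<open>The semiprime condition concludes one membership, not a disjunction as for prime
    ideals, so no choice can vary with the index.\<close>
  moreover have "a \<in> (\<Inter>i\<in>I. Q i)"
    if "a \<in> T" "\<alpha> \<in> \<Gamma>" "\<beta> \<in> \<Gamma>" "tp a \<alpha> a \<beta> a \<in> (\<Inter>i\<in>I. Q i)" for a \<alpha> \<beta>
  proof
    fix i assume "i \<in> I"
    with that(4) have "tp a \<alpha> a \<beta> a \<in> Q i" by blast
    with assms(4)[OF \<open>i \<in> I\<close>] that(1-3) show "a \<in> Q i"
      unfolding tgs_semiprime_ideal_def by blast
  qed
  ultimately show ?thesis
    unfolding tgs_semiprime_ideal_def by (intro conjI ballI impI)
qed

end
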